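(* Let $Y=(0,1)^d$ and let $\sigma\in C_{\rm per}(Y)$ satisfy $\sigma(y)\ge\sigma_{\min}$ for all $y\in Y$, for some constant $\sigma_{\min}>0$. Define, for $\tau\ge0$, $$\mathcal{K}(\tau):=\int_Y\sigma(y)\,e^{-\tau\mathcal{L}_\sigma}\left(\sigma-\langle\sigma\rangle\right)(y)\,dy,$$ and let $\mathcal{M}$ be the memory kernel given through its Laplace transform by $$\widehat{\mathcal{M}}(p)=p+\langle\sigma\rangle-\mathcal{B}(p),\qquad \mathcal{B}(p):=\left(\int_Y\frac{dy}{p+\sigma(y)}\right)^{-1},\qquad p>0.$$ Then for any $p>0$, $$\widehat{\mathcal{K}}(p)=\widehat{\mathcal{M}}(p).$$
   Context: $C_{\rm per}(Y)$ denotes the continuous $Y$-periodic functions on $\mathbb{R}^d$, and $L^2_{\rm per}(Y)$ the $Y$-periodic functions that are square integrable on $Y$. $\langle v\rangle:=\int_Yv(y)\,dy$. $\mathcal{L}_\sigma$ is the bounded linear operator on $L^2_{\rm per}(Y)$ defined by $\mathcal{L}_\sigma v:=\sigma v-\langle\sigma v\rangle$, and $e^{-\tau\mathcal{L}_\sigma}=\sum_{n\ge0}\frac{(-\tau)^n}{n!}\mathcal{L}_\sigma^n$. The Laplace transform of a function $h$ of time is $\widehat{h}(p):=\int_0^\infty e^{-ps}h(s)\,ds$ for $p>0$. *)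

theory Defs
  imports "HOL-Analysis.Analysis"
begin

definition unit_cell :: "(real ^ 'd) set"
  where "unit_cell = box 0 1"

definition periodic :: "(real ^ 'd \<Rightarrow> real) \<Rightarrow> bool"
  where "periodic v \<longleftrightarrow> (\<forall>y i. v (y + axis i 1) = v y)"

definition C_per :: "(real ^ 'd \<Rightarrow> real) set"
  where "C_per = {v. continuous_on UNIV v \<and> periodic v}"

definition mean :: "(real ^ 'd \<Rightarrow> real) \<Rightarrow> real"
  where "mean v = (LINT y:unit_cell|lebesgue. v y)"

text \<open>Elements of the periodic L2 space are represented by functions; two functions represent the
  same element iff the seminorm \<open>L2_norm\<close> of their difference is 0.\<close>

definition L2_per :: "(real ^ 'd \<Rightarrow> real) set"
  where "L2_per = {v \<in> borel_measurable lebesgue.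
    periodic v \<and> set_integrable lebesgue unit_cell (\<lambda>y. (v y)\<^sup>2)}"

definition L2_norm :: "(real ^ 'd \<Rightarrow> real) \<Rightarrow> real"
  where "L2_norm v = sqrt (mean (\<lambda>y. (v y)\<^sup>2))"

definition L_op :: "(real ^ 'd \<Rightarrow> real) \<Rightarrow> (real ^ 'd \<Rightarrow> real) \<Rightarrow> (real ^ 'd \<Rightarrow> real)"
  where "L_op \<sigma> v = (\<lambda>y. \<sigma> y * v y - mean (\<lambda>z. \<sigma> z * v z))"

text \<open>Convergence in the operator norm of the periodic L2 space.\<close>

definition op_limit ::
  "(nat \<Rightarrow> (real ^ 'd \<Rightarrow> real) \<Rightarrow> (real ^ 'd \<Rightarrow> real)) \<Rightarrow>
   ((real ^ 'd \<Rightarrow> real) \<Rightarrow> (real ^ 'd \<Rightarrow> real)) \<Rightarrow> bool"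
  where "op_limit T E \<longleftrightarrow> (\<forall>v\<in>L2_per. E v \<in> L2_per) \<and>
    (\<forall>\<epsilon>>0. \<forall>\<^sub>F N in sequentially.
      \<forall>v\<in>L2_per. L2_norm (\<lambda>y. T N v y - E v y) \<le> \<epsilon> * L2_norm v)"

text \<open>\<open>exp_op A t\<close> is the operator exponential of \<open>t A\<close>, the operator-norm limit of the partial sums
  of the exponential series. For a bounded linear \<open>A\<close> the limit operator is unique up to almost
  everywhere equality of its values on the periodic L2 space; \<open>SOME\<close> picks representatives.\<close>

definition exp_op ::
  "((real ^ 'd \<Rightarrow> real) \<Rightarrow> (real ^ 'd \<Rightarrow> real)) \<Rightarrow> real \<Rightarrow>
   (real ^ 'd \<Rightarrow> real) \<Rightarrow> (real ^ 'd \<Rightarrow> real)"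
  where "exp_op A t = (SOME E. op_limit (\<lambda>N v y. \<Sum>n<N. t ^ n / fact n * (A ^^ n) v y) E)"

definition K_kernel :: "(real ^ 'd \<Rightarrow> real) \<Rightarrow> real \<Rightarrow> real"
  where "K_kernel \<sigma> \<tau> =
    mean (\<lambda>y. \<sigma> y * exp_op (L_op \<sigma>) (- \<tau>) (\<lambda>z. \<sigma> z - mean \<sigma>) y)"

text \<open>The set integral is 0 for a non-integrable integrand, so the existence of the Laplace
  transform is a separate predicate.\<close>

definition laplace_exists :: "(real \<Rightarrow> real) \<Rightarrow> real \<Rightarrow> bool"
  where "laplace_exists h p \<longleftrightarrow> set_integrable lebesgue {0..} (\<lambda>s. exp (- p * s) * h s)"

definition laplace :: "(real \<Rightarrow> real) \<Rightarrow> real \<Rightarrow> real"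
  where "laplace h p = (LINT s:{0..}|lebesgue. exp (- p * s) * h s)"

definition B_fun :: "(real ^ 'd \<Rightarrow> real) \<Rightarrow> real \<Rightarrow> real"
  where "B_fun \<sigma> p = inverse (mean (\<lambda>y. 1 / (p + \<sigma> y)))"

text \<open>The memory kernel is specified only through its Laplace transform, which is this function.\<close>

definition M_laplace :: "(real ^ 'd \<Rightarrow> real) \<Rightarrow> real \<Rightarrow> real"
  where "M_laplace \<sigma> p = p + mean \<sigma> - B_fun \<sigma> p"

end

theory Submission
  imports Defs "HOL-Probability.Distributions"
begin

text \<open>
  The defining series of \<open>\<K>(t) = \<langle>\<sigma> exp(- t L) g\<rangle>\<close>, with \<open>L v = \<sigma> v - \<langle>\<sigma> v\<rangle>\<close> and \<open>g = \<sigma> - \<langle>\<sigma>\<rangle>\<close>, only gives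
  \<open>\<bar>\<K>(t)\<bar> \<le> C exp(t \<parallel>L\<parallel>)\<close>. That bound allows a term by term Laplace transform for large \<open>p\<close>, but
  not for every \<open>p > 0\<close>. The remedy is to shift the exponent. Let \<open>S\<close> be an upper bound of \<open>\<sigma>\<close> and
  \<open>T v = S v - L v = (S - \<sigma>) v + \<langle>\<sigma> v\<rangle>\<close>.
  Up to scaling, \<open>T\<close> is the transition operator of a jump process on the unit cell: it preserves
  positivity and multiplies the mean by \<open>S\<close>. Hence it has norm at most \<open>S\<close> on \<open>L\<^sup>1\<close>
  (\<open>L1_T_le\<close>), and the numbers \<open>c\<^sub>n = \<langle>\<sigma> T\<^sup>n g\<rangle>\<close> grow no faster than \<open>S\<^sup>n\<close>. Since
  \<open>exp(- t L) = exp(- S t) exp(t T)\<close>,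
  \<open>\<K>(t) = exp(- S t) \<Sum>\<^sub>n t\<^sup>n c\<^sub>n / n!\<close>
  (\<open>K_kernel_eq\<close>). The exponential factor balances the growth of the series, so for every \<open>p > 0\<close>
  the Laplace transform exists and equals \<open>c = \<Sum>\<^sub>n c\<^sub>n / q^(n+1)\<close> with \<open>q = p + S\<close>
  (\<open>laplace_power_series\<close>).

  To find \<open>c\<close>, consider the resolvent series \<open>R = \<Sum>\<^sub>n T\<^sup>n g / q^(n+1)\<close>, which converges uniformly by
  \<open>sup_T_power_le\<close>. Shifting the index gives \<open>q R - g = (S - \<sigma>) R + c\<close>, that is,
  \<open>R = (g + c) / (p + \<sigma>)\<close>. All \<open>T\<^sup>n g\<close> have mean 0, so \<open>\<langle>R\<rangle> = 0\<close>, and this is a linear equation for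
  \<open>c\<close> whose solution is \<open>p + \<langle>\<sigma>\<rangle> - \<langle>1 / (p + \<sigma>)\<rangle>^(-1)\<close> (\<open>sum_weighted_means_eq\<close>).

  The exponential is specified by convergence in the operator norm of \<open>L\<^sup>2\<close>. The pointwise bound
  \<open>abs_L_power_le\<close> shows that the pointwise sum of the exponential series is such a limit, so the
  choice in the definition is meaningful; pairing with the bounded function \<open>\<sigma>\<close> is continuous in the
  \<open>L\<^sup>2\<close> norm, so every limit gives the same value of \<open>\<K>\<close> (\<open>mean_weight_exp_op_sums\<close>).
\<close>

section \<open>Scalar series\<close>

text \<open>Pascal's rule, arranged for the induction that expands \<open>(T + b)\<^sup>n\<close> when \<open>u k\<close> is the value of
  \<open>T\<^sup>k v\<close> at a point.\<close>

lemma binomial_sum_step: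
  fixes b :: "'a::comm_ring_1" and u :: "nat \<Rightarrow> 'a"
  shows "(\<Sum>k\<le>n. of_nat (n choose k) * b ^ (n - k) * (u (Suc k) + b * u k)) =
    (\<Sum>k\<le>Suc n. of_nat (Suc n choose k) * b ^ (Suc n - k) * u k)"
proof -
  have "(\<Sum>k\<le>n. of_nat (n choose k) * b ^ (n - k) * (b * u k)) =
      (\<Sum>k\<le>n. of_nat (n choose k) * b ^ (Suc n - k) * u k)"
    by (intro sum.cong) (auto simp: Suc_diff_le mult_ac)
  also have "\<dots> = (\<Sum>k\<le>Suc n. of_nat (n choose k) * b ^ (Suc n - k) * u k)"
    by (simp add: binomial_eq_0)
  also have "\<dots> = b ^ Suc n * u 0 + (\<Sum>k\<le>n. of_nat (n choose Suc k) * b ^ (n - k) * u (Suc k))"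
    by (subst sum.atMost_Suc_shift) simp
  finally show ?thesis
    by (subst sum.atMost_Suc_shift) (simp add: sum.distrib algebra_simps)
qed

text \<open>Each term of the integrand is a multiple of an Erlang density of rate \<open>p + S\<close>, so its integral
  is known, and the growth bound on \<open>c\<close> bounds the integrals of the absolute values by a
  geometric series of ratio \<open>S / (p + S) < 1\<close>.\<close>

lemma laplace_power_series:
  fixes c :: "nat \<Rightarrow> real"
  assumes p: "p > 0" and S: "S \<ge> 0" and c: "\<And>n. \<bar>c n\<bar> \<le> C * S ^ n"
  shows "has_bochner_integral lborel
      (\<lambda>t. indicator {0..} t * (exp (- p * t) * (exp (- S * t) * (\<Sum>n. t ^ n / fact n * c n))))
      (\<Sum>n. c n / (p + S) ^ Suc n)"
proof -
  define q where "q = p + S"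
  have q: "q > 0" using p S by (simp add: q_def)
  define f where "f n t = c n / q ^ Suc n * erlang_density n q t" for n t
  have C: "C \<ge> 0" using c[of 0] by simp
  have mass: "integrable lborel (erlang_density n q) \<and> integral\<^sup>L lborel (erlang_density n q) = 1" for n
  proof -
    have "(\<integral>\<^sup>+ x. ennreal (erlang_density n q x) \<partial>lborel) = ennreal 1"
      using nn_integral_erlang_ith_moment[OF q, of n 0] by simp
    then have "has_bochner_integral lborel (erlang_density n q) 1"
      using q by (intro has_bochner_integral_nn_integral) auto
    then show ?thesis by (simp add: has_bochner_integral_iff)
  qed
  have int_f: "integrable lborel (f n)" "integral\<^sup>L lborel (f n) = c n / q ^ Suc n" for n
    using mass[of n] by (auto simp: f_def[abs_def])
  have int_abs: "(\<integral>t. norm (f n t) \<partial>lborel) = \<bar>c n\<bar> / q ^ Suc n" for n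
  proof -
    have "(\<lambda>t. norm (f n t)) = (\<lambda>t. \<bar>c n\<bar> / q ^ Suc n * erlang_density n q t)"
      using q by (auto simp: f_def abs_mult)
    then show ?thesis using mass[of n] by simp
  qed
  have geom: "summable (\<lambda>n. \<bar>c n\<bar> / q ^ Suc n)"
  proof (rule summable_comparison_test')
    show "summable (\<lambda>n. C / q * (S / q) ^ n)"
      using S p q by (intro summable_mult summable_geometric) (auto simp: q_def)
    show "norm (\<bar>c n\<bar> / q ^ Suc n) \<le> C / q * (S / q) ^ n" for n
      using c[of n] q by (simp add: power_divide divide_right_mono)
  qed
  have pos_sums: "(\<lambda>n. f n t) sums (exp (- q * t) * (\<Sum>n. t ^ n / fact n * c n))"
    and pos_abs: "summable (\<lambda>n. norm (f n t))" if t: "t \<ge> 0" for t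
  proof -
    have f_eq: "f n t = exp (- q * t) * (t ^ n / fact n * c n)" for n
      using t q by (simp add: f_def erlang_density_def field_simps)
    have abs: "summable (\<lambda>n. norm (t ^ n / fact n * c n))"
    proof (rule summable_comparison_test')
      show "summable (\<lambda>n. C * (inverse (fact n) * (S * t) ^ n))"
        by (intro summable_mult summable_exp)
      show "norm (norm (t ^ n / fact n * c n)) \<le> C * (inverse (fact n) * (S * t) ^ n)" for n
        using mult_left_mono[OF c[of n], of "t ^ n / fact n"] t
        by (simp add: abs_mult power_mult_distrib field_simps)
    qed
    show "(\<lambda>n. f n t) sums (exp (- q * t) * (\<Sum>n. t ^ n / fact n * c n))"
      unfolding f_eq using summable_norm_cancel[OF abs] by (intro sums_mult summable_sums)
    show "summable (\<lambda>n. norm (f n t))"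
      unfolding f_eq norm_mult[of "exp (- q * t)"] by (intro summable_mult abs)
  qed
  have neg: "f n t = 0" if "t < 0" for n t
    using that by (simp add: f_def erlang_density_def)
  have abs_f: "summable (\<lambda>n. norm (f n t))" for t
    using pos_abs[of t] by (cases "t < 0") (simp_all add: neg)
  have "(\<Sum>n. f n t) =
      indicator {0..} t * (exp (- p * t) * (exp (- S * t) * (\<Sum>n. t ^ n / fact n * c n)))" for t
  proof (cases "t < 0")
    case False
    then have "(\<Sum>n. f n t) = exp (- q * t) * (\<Sum>n. t ^ n / fact n * c n)"
      using pos_sums[of t] by (simp add: sums_iff)
    moreover have "exp (- q * t) = exp (- p * t) * exp (- S * t)"
      by (simp add: q_def exp_add[symmetric] algebra_simps)
    ultimately show ?thesis using False by simp
  qed (simp add: neg)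
  then have eq: "(\<lambda>t. \<Sum>n. f n t) =
      (\<lambda>t. indicator {0..} t * (exp (- p * t) * (exp (- S * t) * (\<Sum>n. t ^ n / fact n * c n))))"
    by auto
  have "integrable lborel (\<lambda>t. \<Sum>n. f n t)"
    using int_f geom abs_f by (intro integrable_suminf) (auto simp only: int_abs intro!: AE_I2)
  moreover have "integral\<^sup>L lborel (\<lambda>t. \<Sum>n. f n t) = (\<Sum>n. c n / q ^ Suc n)"
    using int_f geom abs_f by (subst integral_suminf) (auto simp only: int_abs intro!: AE_I2)
  ultimately show ?thesis
    by (simp add: has_bochner_integral_iff eq q_def)
qed

section \<open>Multiplication operators with the mean subtracted\<close>

text \<open>The analysis of the operator uses only that the unit cell carries a probability measure and that
  \<open>\<sigma>\<close> is measurable and bounded between positive constants.\<close>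

locale bounded_weight = prob_space M for M :: "'a measure" +
  fixes \<sigma> :: "'a \<Rightarrow> real" and m S :: real
  assumes weight_measurable [measurable]: "\<sigma> \<in> borel_measurable M"
    and m_pos: "0 < m"
    and weight_ge: "\<And>y. y \<in> space M \<Longrightarrow> m \<le> \<sigma> y"
    and weight_le: "\<And>y. y \<in> space M \<Longrightarrow> \<sigma> y \<le> S"
begin

definition L :: "('a \<Rightarrow> real) \<Rightarrow> 'a \<Rightarrow> real"
  where "L v = (\<lambda>y. \<sigma> y * v y - (\<integral>z. \<sigma> z * v z \<partial>M))"

text \<open>\<open>T = S - L\<close>, written so that its positivity is visible.\<close>

definition T :: "('a \<Rightarrow> real) \<Rightarrow> 'a \<Rightarrow> real"
  where "T v = (\<lambda>y. (S - \<sigma> y) * v y + (\<integral>z. \<sigma> z * v z \<partial>M))"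

lemma m_le_S: "m \<le> S"
proof -
  obtain y where "y \<in> space M" using not_empty by blast
  then show ?thesis using weight_ge weight_le by fastforce
qed

lemma S_pos: "0 < S"
  using m_le_S m_pos by simp

lemma abs_weight_le: "y \<in> space M \<Longrightarrow> \<bar>\<sigma> y\<bar> \<le> S"
  using weight_ge[of y] weight_le[of y] m_pos by simp

lemma integrable_weight_mult:
  assumes "integrable M v"
  shows "integrable M (\<lambda>y. \<sigma> y * v y)"
proof (rule Bochner_Integration.integrable_bound)
  show "integrable M (\<lambda>y. S * v y)" using assms by simp
  show "AE y in M. norm (\<sigma> y * v y) \<le> norm (S * v y)"
    using abs_weight_le S_pos by (auto intro!: AE_I2 mult_right_mono simp: abs_mult)
qed (use assms in measurable)

lemma abs_integral_weight_mult_le: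
  assumes "integrable M v"
  shows "\<bar>\<integral>y. \<sigma> y * v y \<partial>M\<bar> \<le> S * (\<integral>y. \<bar>v y\<bar> \<partial>M)"
proof -
  have "\<bar>\<integral>y. \<sigma> y * v y \<partial>M\<bar> \<le> (\<integral>y. \<bar>\<sigma> y * v y\<bar> \<partial>M)"
    by (rule integral_abs_bound)
  also have "\<dots> \<le> (\<integral>y. S * \<bar>v y\<bar> \<partial>M)"
  proof (rule integral_mono)
    show "integrable M (\<lambda>y. \<bar>\<sigma> y * v y\<bar>)"
      by (intro integrable_abs integrable_weight_mult assms)
    show "\<bar>\<sigma> y * v y\<bar> \<le> S * \<bar>v y\<bar>" if "y \<in> space M" for y
      using abs_weight_le[OF that] by (simp add: abs_mult mult_right_mono)
  qed (use assms in simp)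
  finally show ?thesis by simp
qed

lemma integrable_L: "integrable M v \<Longrightarrow> integrable M (L v)"
  unfolding L_def by (intro Bochner_Integration.integrable_diff integrable_weight_mult) auto

lemma integrable_T: "integrable M v \<Longrightarrow> integrable M (T v)"
  unfolding T_def left_diff_distrib
  by (intro Bochner_Integration.integrable_add Bochner_Integration.integrable_diff
      integrable_weight_mult) auto

lemma integrable_L_power: "integrable M v \<Longrightarrow> integrable M ((L ^^ n) v)"
  by (induction n) (auto intro: integrable_L)

lemma integrable_T_power: "integrable M v \<Longrightarrow> integrable M ((T ^^ n) v)"
  by (induction n) (auto intro: integrable_T)

lemma integral_T:
  assumes "integrable M v"
  shows "integral\<^sup>L M (T v) = S * integral\<^sup>L M v"
  using assms integrable_weight_mult[OF assms] by (simp add: T_def left_diff_distrib prob_space)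

lemma integral_T_power:
  assumes "integrable M v"
  shows "integral\<^sup>L M ((T ^^ n) v) = S ^ n * integral\<^sup>L M v"
  by (induction n) (auto simp: integral_T integrable_T_power assms)

text \<open>By positivity \<open>\<bar>T v\<bar> \<le> T \<bar>v\<bar>\<close>, and \<open>T\<close> multiplies means by \<open>S\<close>.\<close>

lemma L1_T_le:
  assumes v: "integrable M v"
  shows "(\<integral>y. \<bar>T v y\<bar> \<partial>M) \<le> S * (\<integral>y. \<bar>v y\<bar> \<partial>M)"
proof -
  have int: "integrable M (\<lambda>y. \<sigma> y * \<bar>v y\<bar>)"
    using v by (intro integrable_weight_mult) simp
  have "\<bar>\<integral>z. \<sigma> z * v z \<partial>M\<bar> \<le> (\<integral>z. \<bar>\<sigma> z * v z\<bar> \<partial>M)"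
    by (rule integral_abs_bound)
  also have "\<dots> = (\<integral>z. \<sigma> z * \<bar>v z\<bar> \<partial>M)"
    using weight_ge m_pos by (intro Bochner_Integration.integral_cong) (force simp: abs_mult)+
  finally have abs_mean: "\<bar>\<integral>z. \<sigma> z * v z \<partial>M\<bar> \<le> (\<integral>z. \<sigma> z * \<bar>v z\<bar> \<partial>M)" .
  have "(\<integral>y. \<bar>T v y\<bar> \<partial>M) \<le> (\<integral>y. T (\<lambda>z. \<bar>v z\<bar>) y \<partial>M)"
  proof (rule integral_mono)
    fix y assume y: "y \<in> space M"
    have "\<bar>T v y\<bar> \<le> \<bar>(S - \<sigma> y) * v y\<bar> + \<bar>\<integral>z. \<sigma> z * v z \<partial>M\<bar>"
      unfolding T_def by (rule abs_triangle_ineq)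
    also have "\<bar>(S - \<sigma> y) * v y\<bar> = (S - \<sigma> y) * \<bar>v y\<bar>"
      using weight_le[OF y] by (simp add: abs_mult)
    finally show "\<bar>T v y\<bar> \<le> T (\<lambda>z. \<bar>v z\<bar>) y"
      using abs_mean by (simp add: T_def)
  qed (use v in \<open>auto intro!: integrable_T\<close>)
  also have "\<dots> = S * (\<integral>y. \<bar>v y\<bar> \<partial>M)"
    using v by (subst integral_T) auto
  finally show ?thesis .
qed

lemma L1_T_power_le:
  assumes "integrable M v"
  shows "(\<integral>y. \<bar>(T ^^ n) v y\<bar> \<partial>M) \<le> S ^ n * (\<integral>y. \<bar>v y\<bar> \<partial>M)"
proof (induction n)
  case (Suc n)
  have "(\<integral>y. \<bar>(T ^^ Suc n) v y\<bar> \<partial>M) \<le> S * (\<integral>y. \<bar>(T ^^ n) v y\<bar> \<partial>M)"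
    using L1_T_le[OF integrable_T_power[OF assms, of n]] by simp
  also have "\<dots> \<le> S * (S ^ n * (\<integral>y. \<bar>v y\<bar> \<partial>M))"
    using Suc S_pos by (intro mult_left_mono) auto
  finally show ?case by simp
qed simp

lemma abs_integral_weight_T_power_le:
  assumes "integrable M v"
  shows "\<bar>\<integral>y. \<sigma> y * (T ^^ n) v y \<partial>M\<bar> \<le> S * (\<integral>y. \<bar>v y\<bar> \<partial>M) * S ^ n"
proof -
  have "\<bar>\<integral>y. \<sigma> y * (T ^^ n) v y \<partial>M\<bar> \<le> S * (\<integral>y. \<bar>(T ^^ n) v y\<bar> \<partial>M)"
    by (intro abs_integral_weight_mult_le integrable_T_power assms)
  also have "\<dots> \<le> S * (S ^ n * (\<integral>y. \<bar>v y\<bar> \<partial>M))"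
    using S_pos by (intro mult_left_mono L1_T_power_le assms) auto
  finally show ?thesis by (simp add: mult_ac)
qed

text \<open>In the sup norm the mean that \<open>T\<close> adds is a source term, and the factor \<open>S - \<sigma> \<le> S - m\<close> in front
  of the previous iterate leaves room to absorb it: with \<open>A\<close> the \<open>L\<^sup>1\<close> norm of \<open>v\<close>, the constant \<open>C\<close> has
  to satisfy \<open>(S - m) C + S A \<le> S C\<close>, which is why \<open>S A / m\<close> appears.\<close>

lemma sup_T_power_le:
  assumes v: "integrable M v" and B: "\<And>y. y \<in> space M \<Longrightarrow> \<bar>v y\<bar> \<le> B" and y: "y \<in> space M"
  shows "\<bar>(T ^^ n) v y\<bar> \<le> (B + S * (\<integral>y. \<bar>v y\<bar> \<partial>M) / m) * S ^ n"
proof (induction n)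
  case 0
  have "0 \<le> S * (\<integral>y. \<bar>v y\<bar> \<partial>M) / m" using S_pos m_pos by auto
  then show ?case using B[OF y] by auto
next
  case (Suc n)
  define A C where "A = (\<integral>y. \<bar>v y\<bar> \<partial>M)" and "C = B + S * A / m"
  have A: "A \<ge> 0" by (simp add: A_def)
  have "B \<ge> 0" using B[OF y] by simp
  then have C: "C \<ge> 0" "S * A \<le> m * C"
    using A S_pos m_pos by (auto simp: C_def field_simps)
  have "\<bar>(T ^^ Suc n) v y\<bar> \<le> \<bar>(S - \<sigma> y) * (T ^^ n) v y\<bar> + \<bar>\<integral>z. \<sigma> z * (T ^^ n) v z \<partial>M\<bar>"
    by (simp add: T_def)
  also have "\<bar>(S - \<sigma> y) * (T ^^ n) v y\<bar> \<le> (S - m) * (C * S ^ n)"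
    unfolding abs_mult using weight_le[OF y] weight_ge[OF y] Suc
    by (intro mult_mono) (auto simp: C_def A_def)
  also have "\<bar>\<integral>z. \<sigma> z * (T ^^ n) v z \<partial>M\<bar> \<le> S * A * S ^ n"
    unfolding A_def by (rule abs_integral_weight_T_power_le[OF v])
  also have "S * A * S ^ n \<le> m * C * S ^ n"
    using C S_pos by (intro mult_right_mono) auto
  also have "(S - m) * (C * S ^ n) + m * C * S ^ n = C * S ^ Suc n"
    by (simp add: algebra_simps)
  finally show ?case by (simp add: C_def A_def)
qed

lemma L_eq: "L v y = S * v y - T v y"
  by (simp add: L_def T_def algebra_simps)

lemma L_sum:
  assumes "\<And>k. k \<in> I \<Longrightarrow> integrable M (f k)"
  shows "L (\<lambda>z. \<Sum>k\<in>I. \<alpha> k * f k z) y = (\<Sum>k\<in>I. \<alpha> k * L (f k) y)"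
proof -
  have "(\<integral>z. \<sigma> z * (\<Sum>k\<in>I. \<alpha> k * f k z) \<partial>M) = (\<integral>z. (\<Sum>k\<in>I. \<alpha> k * (\<sigma> z * f k z)) \<partial>M)"
    by (simp add: sum_distrib_left mult_ac)
  also have "\<dots> = (\<Sum>k\<in>I. \<alpha> k * (\<integral>z. \<sigma> z * f k z \<partial>M))"
    using assms by (subst Bochner_Integration.integral_sum) (auto intro: integrable_weight_mult)
  finally show ?thesis
    by (simp add: L_def sum_distrib_left right_diff_distrib sum_subtractf mult_ac)
qed

lemma L_power_eq:
  assumes "integrable M v"
  shows "(L ^^ n) v y =
    (-1) ^ n * (\<Sum>k\<le>n. of_nat (n choose k) * (- S) ^ (n - k) * (T ^^ k) v y)"
proof (induction n arbitrary: y)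
  case (Suc n)
  let ?\<alpha> = "\<lambda>k. of_nat (n choose k) * (- S) ^ (n - k) :: real"
  have "(L ^^ n) v = (\<lambda>y. \<Sum>k\<le>n. ((-1) ^ n * ?\<alpha> k) * (T ^^ k) v y)"
    by (auto simp: Suc sum_distrib_left mult_ac)
  then have "(L ^^ Suc n) v y = (\<Sum>k\<le>n. ((-1) ^ n * ?\<alpha> k) * L ((T ^^ k) v) y)"
    using L_sum[of "{..n}" "\<lambda>k. (T ^^ k) v"] integrable_T_power[OF assms] by simp
  also have "\<dots> = (-1) ^ Suc n * (\<Sum>k\<le>n. ?\<alpha> k * ((T ^^ Suc k) v y + (- S) * (T ^^ k) v y))"
    by (simp add: L_eq sum_distrib_left algebra_simps sum_negf[symmetric])
  finally show ?case
    by (simp only: binomial_sum_step[of n "- S" "\<lambda>k. (T ^^ k) v y"])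
qed simp

text \<open>The identity \<open>exp(- t L) = exp(- S t) exp(t T)\<close>, tested against \<open>\<sigma>\<close>. After testing it is an identity
  between scalar series, namely the Cauchy product of the two exponentials on the right.\<close>

lemma exp_series_L_eq_T:
  assumes v: "integrable M v"
  shows "(\<lambda>n. (- t) ^ n / fact n * (\<integral>y. \<sigma> y * (L ^^ n) v y \<partial>M)) sums
    (exp (- S * t) * (\<Sum>n. t ^ n / fact n * (\<integral>y. \<sigma> y * (T ^^ n) v y \<partial>M)))"
proof -
  define c where "c n = (\<integral>y. \<sigma> y * (T ^^ n) v y \<partial>M)" for n
  define C where "C = S * (\<integral>y. \<bar>v y\<bar> \<partial>M)"
  have c: "\<bar>c n\<bar> \<le> C * S ^ n" for n
    unfolding c_def C_def by (rule abs_integral_weight_T_power_le[OF v])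
  have a: "(\<integral>y. \<sigma> y * (L ^^ n) v y \<partial>M) =
      (-1) ^ n * (\<Sum>k\<le>n. of_nat (n choose k) * (- S) ^ (n - k) * c k)" for n
  proof -
    have "(\<integral>y. \<sigma> y * (L ^^ n) v y \<partial>M) =
      (\<integral>y. (-1) ^ n * (\<Sum>k\<le>n. of_nat (n choose k) * (- S) ^ (n - k) * (\<sigma> y * (T ^^ k) v y)) \<partial>M)"
      by (simp add: L_power_eq[OF v] sum_distrib_left mult_ac)
    also have "\<dots> = (-1) ^ n * (\<Sum>k\<le>n. of_nat (n choose k) * (- S) ^ (n - k) * c k)"
      unfolding integral_mult_right_zero c_def
      by (subst Bochner_Integration.integral_sum)
        (auto intro!: integrable_mult_right integrable_weight_mult integrable_T_power v)
    finally show ?thesis .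
  qed
  have abs: "summable (\<lambda>n. norm (t ^ n / fact n * c n))"
  proof (rule summable_comparison_test')
    show "summable (\<lambda>n. C * (inverse (fact n) * (S * \<bar>t\<bar>) ^ n))"
      by (intro summable_mult summable_exp)
    show "norm (norm (t ^ n / fact n * c n)) \<le> C * (inverse (fact n) * (S * \<bar>t\<bar>) ^ n)" for n
      using mult_left_mono[OF c[of n], of "\<bar>t\<bar> ^ n / fact n"]
      by (simp add: abs_mult power_mult_distrib field_simps power_abs)
  qed
  have exp_abs: "summable (\<lambda>n. norm ((- S * t) ^ n /\<^sub>R fact n))"
    by (rule summable_norm_exp)
  have "(\<lambda>n. \<Sum>k\<le>n. (t ^ k / fact k * c k) * ((- S * t) ^ (n - k) /\<^sub>R fact (n - k))) sums
      ((\<Sum>n. t ^ n / fact n * c n) * exp (- S * t))"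
    unfolding exp_def using Cauchy_product_sums[OF abs exp_abs] by simp
  moreover have "(\<Sum>k\<le>n. (t ^ k / fact k * c k) * ((- S * t) ^ (n - k) /\<^sub>R fact (n - k))) =
      (- t) ^ n / fact n * (\<integral>y. \<sigma> y * (L ^^ n) v y \<partial>M)" for n
  proof -
    have "(- t) ^ n / fact n * (\<integral>y. \<sigma> y * (L ^^ n) v y \<partial>M) =
        t ^ n / fact n * (\<Sum>k\<le>n. of_nat (n choose k) * (- S) ^ (n - k) * c k)"
      by (simp add: a power_minus[of t])
    also have "\<dots> = (\<Sum>k\<le>n. (t ^ k / fact k * c k) * ((- S * t) ^ (n - k) /\<^sub>R fact (n - k)))"
      unfolding sum_distrib_left
    proof (rule sum.cong)
      fix k assume "k \<in> {..n}"
      then have k: "k \<le> n" by simp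
      have "t ^ n = t ^ k * t ^ (n - k)" using k by (simp flip: power_add)
      moreover have "(- S * t) ^ (n - k) = (- S) ^ (n - k) * t ^ (n - k)"
        by (rule power_mult_distrib)
      ultimately show "t ^ n / fact n * (of_nat (n choose k) * (- S) ^ (n - k) * c k) =
          (t ^ k / fact k * c k) * ((- S * t) ^ (n - k) /\<^sub>R fact (n - k))"
        by (simp only:) (simp add: binomial_fact[OF k] divide_inverse mult_ac)
    qed simp
    finally show ?thesis by simp
  qed
  ultimately show ?thesis by (simp add: c_def mult.commute)
qed

text \<open>The left side is the constant \<open>c\<close> in the resolvent equation \<open>(p + \<sigma>) R = g + c\<close>, where \<open>R\<close> is the
  Neumann series of \<open>(p + S - T)^(-1) g\<close>; it is determined by \<open>R\<close> having mean 0.\<close>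

lemma sum_weighted_means_eq:
  assumes p: "p > 0"
  defines "g \<equiv> \<lambda>y. \<sigma> y - integral\<^sup>L M \<sigma>"
  shows "(\<Sum>n. (\<integral>y. \<sigma> y * (T ^^ n) g y \<partial>M) / (p + S) ^ Suc n) =
    p + integral\<^sup>L M \<sigma> - inverse (\<integral>y. 1 / (p + \<sigma> y) \<partial>M)"
proof -
  define q where "q = p + S"
  have q: "q > 0" using p S_pos by (simp add: q_def)
  define c where "c n = (\<integral>y. \<sigma> y * (T ^^ n) g y \<partial>M)" for n
  define w where "w n = (T ^^ n) g" for n
  have int_\<sigma>: "integrable M \<sigma>"
    using integrable_weight_mult[of "\<lambda>_. 1"] by simp
  have g: "integrable M g" using int_\<sigma> by (simp add: g_def)
  have mean_g: "integral\<^sup>L M g = 0" using int_\<sigma> by (simp add: g_def prob_space)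
  define C where "C = S * (\<integral>y. \<bar>g y\<bar> \<partial>M)"
  have c: "\<bar>c n\<bar> \<le> C * S ^ n" for n
    unfolding c_def C_def by (rule abs_integral_weight_T_power_le[OF g])
  (* The bound given by sup_T_power_le, as |g| <= S + |mean of \<sigma>|. *)
  define D where "D = (S + \<bar>integral\<^sup>L M \<sigma>\<bar>) + S * (\<integral>y. \<bar>g y\<bar> \<partial>M) / m"
  have w: "\<bar>w n y\<bar> \<le> D * S ^ n" if "y \<in> space M" for n y
    unfolding w_def D_def
  proof (rule sup_T_power_le[OF g _ that])
    show "\<bar>g y\<bar> \<le> S + \<bar>integral\<^sup>L M \<sigma>\<bar>" if "y \<in> space M" for y
      using abs_weight_le[OF that] by (simp add: g_def)
  qed
  have geom: "summable (\<lambda>n. A * S ^ n / q ^ Suc n)" for A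
  proof -
    have "summable (\<lambda>n. A / q * (S / q) ^ n)"
      using p q S_pos by (intro summable_mult summable_geometric) (auto simp: q_def)
    then show ?thesis by (simp add: power_divide)
  qed
  have sum_c: "summable (\<lambda>n. c n / q ^ Suc n)"
    using q c by (intro summable_comparison_test'[OF geom[of C]]) (auto intro!: divide_right_mono)
  have w_le: "norm (w n y / q ^ Suc n) \<le> D * S ^ n / q ^ Suc n" if "y \<in> space M" for n y
    using q w[OF that] by (auto intro!: divide_right_mono)
  have sum_w: "summable (\<lambda>n. norm (w n y / q ^ Suc n))" if "y \<in> space M" for y
    using w_le[OF that] by (intro summable_comparison_test'[OF geom[of D]]) simp
  have int_w: "integrable M (\<lambda>y. w n y / q ^ Suc n)" for n
    unfolding w_def using integrable_T_power[OF g] by auto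
  define R where "R y = (\<Sum>n. w n y / q ^ Suc n)" for y
  define k where "k = (\<Sum>n. c n / q ^ Suc n)"
  (* The resolvent equation: compare the series of R with the same series shifted by one index. *)
  have R_eq: "R y = (g y + k) / (p + \<sigma> y)" if y: "y \<in> space M" for y
  proof -
    have sums_R: "(\<lambda>n. w n y / q ^ Suc n) sums R y"
      unfolding R_def by (rule summable_sums[OF summable_norm_cancel[OF sum_w[OF y]]])
    have "(\<lambda>n. ((S - \<sigma> y) * (w n y / q ^ Suc n) + c n / q ^ Suc n) / q) sums
        (((S - \<sigma> y) * R y + k) / q)"
      unfolding k_def by (intro sums_divide sums_add sums_mult sums_R summable_sums sum_c)
    moreover have "((S - \<sigma> y) * (w n y / q ^ Suc n) + c n / q ^ Suc n) / q =
        w (Suc n) y / q ^ Suc (Suc n)" for n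
      by (simp add: w_def c_def T_def add_divide_distrib mult_ac)
    moreover have "(\<lambda>n. w (Suc n) y / q ^ Suc (Suc n)) sums (R y - w 0 y / q ^ Suc 0)"
      using sums_R by (subst sums_Suc_iff) simp
    ultimately have "R y - g y / q = ((S - \<sigma> y) * R y + k) / q"
      by (auto simp: w_def dest: sums_unique2)
    then have "(p + \<sigma> y) * R y = g y + k"
      using q by (simp add: field_simps) (simp add: q_def algebra_simps)
    moreover have "p + \<sigma> y > 0" using p m_pos weight_ge[OF y] by simp
    ultimately show ?thesis by (simp add: field_simps)
  qed
  have "integral\<^sup>L M R = (\<Sum>n. \<integral>y. w n y / q ^ Suc n \<partial>M)"
    unfolding R_def
  proof (rule integral_suminf[OF int_w])
    show "AE y in M. summable (\<lambda>n. norm (w n y / q ^ Suc n))"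
      using sum_w by (intro AE_I2)
    show "summable (\<lambda>n. \<integral>y. norm (w n y / q ^ Suc n) \<partial>M)"
    proof (rule summable_comparison_test'[OF geom[of D]])
      fix n
      have "(\<integral>y. norm (w n y / q ^ Suc n) \<partial>M) \<le> (\<integral>y. D * S ^ n / q ^ Suc n \<partial>M)"
        by (intro integral_mono integrable_norm int_w w_le) auto
      then show "norm (\<integral>y. norm (w n y / q ^ Suc n) \<partial>M) \<le> D * S ^ n / q ^ Suc n"
        by (simp add: prob_space)
    qed
  qed
  also have "\<dots> = 0"
    using integral_T_power[OF g] by (simp add: w_def mean_g)
  finally have mean_R: "integral\<^sup>L M R = 0" .
  (* g + k = (p + \<sigma>) + b, so dividing by p + \<sigma> leaves the mean of 1 / (p + \<sigma>) as the only integral. *)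
  define b where "b = k - integral\<^sup>L M \<sigma> - p"
  have inv_le: "\<bar>1 / (p + \<sigma> y)\<bar> \<le> 1 / p" if "y \<in> space M" for y
    using weight_ge[OF that] p m_pos by (auto simp: field_simps)
  have int_inv: "integrable M (\<lambda>y. 1 / (p + \<sigma> y))"
    using inv_le by (intro integrable_const_bound[where B="1 / p"]) auto
  have "integral\<^sup>L M R = (\<integral>y. 1 + b * (1 / (p + \<sigma> y)) \<partial>M)"
  proof (rule Bochner_Integration.integral_cong[OF refl])
    fix y assume y: "y \<in> space M"
    have "p + \<sigma> y \<noteq> 0" using p m_pos weight_ge[OF y] by simp
    then show "R y = 1 + b * (1 / (p + \<sigma> y))"
      by (simp add: R_eq[OF y] g_def b_def field_simps)
  qed
  also have "\<dots> = 1 + b * (\<integral>y. 1 / (p + \<sigma> y) \<partial>M)"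
    using int_inv by (simp add: prob_space del: times_divide_eq_right)
  finally have "1 + b * (\<integral>y. 1 / (p + \<sigma> y) \<partial>M) = 0" using mean_R by simp
  then have "b * (\<integral>y. 1 / (p + \<sigma> y) \<partial>M) = - 1" by simp
  then have "inverse (\<integral>y. 1 / (p + \<sigma> y) \<partial>M) = - b"
    by (intro inverse_unique) (simp add: mult.commute)
  then show ?thesis by (simp add: b_def k_def c_def q_def)
qed

text \<open>Unlike an operator norm estimate, this pointwise bound makes the exponential series converge at
  every point, for every integrable \<open>v\<close>; since \<open>L\<close> mixes points only through a mean, the value at \<open>y\<close>
  and the \<open>L\<^sup>1\<close> norm of \<open>v\<close> suffice. In each step the mean contributes at most \<open>2 S\<close> times the
  \<open>L\<^sup>1\<close> norm, whence the factor 3.\<close>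

lemma abs_L_power_le:
  assumes v: "integrable M v" and y: "y \<in> space M"
  shows "\<bar>(L ^^ n) v y\<bar> \<le> (3 * S) ^ n * (\<bar>v y\<bar> + (\<integral>z. \<bar>v z\<bar> \<partial>M))"
  using y
proof (induction n arbitrary: y)
  case (Suc n)
  define A where "A = (\<integral>z. \<bar>v z\<bar> \<partial>M)"
  have "S * (\<integral>z. \<bar>(L ^^ n) v z\<bar> \<partial>M) \<le> S * (\<integral>z. (3 * S) ^ n * (\<bar>v z\<bar> + A) \<partial>M)"
    using v S_pos Suc.IH unfolding A_def
    by (intro mult_left_mono integral_mono integrable_L_power integrable_abs) auto
  then have "\<bar>\<integral>z. \<sigma> z * (L ^^ n) v z \<partial>M\<bar> \<le> S * (\<integral>z. (3 * S) ^ n * (\<bar>v z\<bar> + A) \<partial>M)"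
    using abs_integral_weight_mult_le[OF integrable_L_power[OF v, of n]] by linarith
  also have "\<dots> = S * ((3 * S) ^ n * (2 * A))"
    using v by (simp add: A_def prob_space)
  finally have "\<bar>\<integral>z. \<sigma> z * (L ^^ n) v z \<partial>M\<bar> \<le> S * ((3 * S) ^ n * (2 * A))" .
  moreover have "\<bar>(L ^^ Suc n) v y\<bar> \<le> \<bar>\<sigma> y * (L ^^ n) v y\<bar> + \<bar>\<integral>z. \<sigma> z * (L ^^ n) v z \<partial>M\<bar>"
    by (simp add: L_def)
  moreover have "\<bar>\<sigma> y * (L ^^ n) v y\<bar> \<le> S * ((3 * S) ^ n * (\<bar>v y\<bar> + A))"
    unfolding abs_mult A_def using S_pos
    by (intro mult_mono abs_weight_le Suc) auto
  moreover have "S * ((3 * S) ^ n * (\<bar>v y\<bar> + A)) + S * ((3 * S) ^ n * (2 * A)) \<le>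
      (3 * S) ^ Suc n * (\<bar>v y\<bar> + A)"
  proof -
    have "(3 * S) ^ n * S * (\<bar>v y\<bar> + A + 2 * A) \<le> (3 * S) ^ n * S * (3 * (\<bar>v y\<bar> + A))"
      using S_pos by (intro mult_left_mono) auto
    then show ?thesis by (simp add: algebra_simps)
  qed
  ultimately have "\<bar>(L ^^ Suc n) v y\<bar> \<le> (3 * S) ^ Suc n * (\<bar>v y\<bar> + A)"
    by linarith
  then show ?case by (simp add: A_def)
qed simp

lemma exp_series_L_tail:
  assumes v: "integrable M v" and y: "y \<in> space M"
  shows "\<bar>(\<Sum>n<N. t ^ n / fact n * (L ^^ n) v y) - (\<Sum>n. t ^ n / fact n * (L ^^ n) v y)\<bar> \<le>
    (\<Sum>n. (3 * S * \<bar>t\<bar>) ^ (n + N) /\<^sub>R fact (n + N)) * (\<bar>v y\<bar> + (\<integral>z. \<bar>v z\<bar> \<partial>M))"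
proof -
  define A where "A = \<bar>v y\<bar> + (\<integral>z. \<bar>v z\<bar> \<partial>M)"
  let ?f = "\<lambda>n. t ^ n / fact n * (L ^^ n) v y"
  let ?e = "\<lambda>n. (3 * S * \<bar>t\<bar>) ^ n /\<^sub>R fact n"
  have le: "norm (?f n) \<le> ?e n * A" for n
    using mult_left_mono[OF abs_L_power_le[OF v y, of n], of "\<bar>t\<bar> ^ n / fact n"]
    by (simp add: A_def abs_mult power_mult_distrib power_abs field_simps)
  have e: "summable ?e" by (rule summable_exp_generic)
  then have eA: "summable (\<lambda>n. ?e n * A)" by (rule summable_mult2)
  have eA': "summable (\<lambda>n. ?e (n + N) * A)" using summable_ignore_initial_segment[OF eA] .
  have f: "summable ?f" by (rule summable_comparison_test'[OF eA le])
  have "(\<Sum>n. ?f n) = (\<Sum>n. ?f (n + N)) + (\<Sum>n<N. ?f n)"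
    by (rule suminf_split_initial_segment[OF f])
  then have "\<bar>(\<Sum>n<N. ?f n) - (\<Sum>n. ?f n)\<bar> = norm (\<Sum>n. ?f (n + N))" by simp
  also have "\<dots> \<le> (\<Sum>n. ?e (n + N) * A)"
    by (rule norm_suminf_le[OF le eA'])
  also have "\<dots> = (\<Sum>n. ?e (n + N)) * A"
    by (rule suminf_mult2[symmetric, OF summable_ignore_initial_segment[OF e]])
  finally show ?thesis by (simp add: A_def)
qed

lemma exp_series_L_partial_le:
  assumes v: "integrable M v" and y: "y \<in> space M"
  shows "\<bar>\<Sum>n<N. t ^ n / fact n * (L ^^ n) v y\<bar> \<le>
    (\<Sum>n<N. \<bar>t\<bar> ^ n / fact n * (3 * S) ^ n) * (\<bar>v y\<bar> + (\<integral>z. \<bar>v z\<bar> \<partial>M))"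
proof -
  have "\<bar>\<Sum>n<N. t ^ n / fact n * (L ^^ n) v y\<bar> \<le> (\<Sum>n<N. \<bar>t ^ n / fact n * (L ^^ n) v y\<bar>)"
    by (rule sum_abs)
  also have "\<dots> \<le> (\<Sum>n<N. \<bar>t\<bar> ^ n / fact n * ((3 * S) ^ n * (\<bar>v y\<bar> + (\<integral>z. \<bar>v z\<bar> \<partial>M))))"
    unfolding abs_mult by (intro sum_mono mult_mono abs_L_power_le v y) (auto simp: power_abs)
  finally show ?thesis by (simp only: sum_distrib_right mult.assoc)
qed

end

section \<open>Square integrability on a probability space\<close>

text \<open>The difference of the two sides is the variance of \<open>\<bar>v\<bar>\<close>.\<close>

lemma (in prob_space) L1_sq_le_L2_sq:
  fixes v :: "'a \<Rightarrow> real"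
  assumes [measurable]: "v \<in> borel_measurable M" and v2: "integrable M (\<lambda>y. (v y)\<^sup>2)"
  shows "(\<integral>y. \<bar>v y\<bar> \<partial>M)\<^sup>2 \<le> (\<integral>y. (v y)\<^sup>2 \<partial>M)"
proof -
  have "integrable M (\<lambda>y. \<bar>v y\<bar>)"
    using square_integrable_imp_integrable[OF _ v2] by simp
  then show ?thesis
    using variance_eq[of "\<lambda>y. \<bar>v y\<bar>"] variance_positive[of "\<lambda>y. \<bar>v y\<bar>"] v2 by simp
qed

text \<open>Turns the pointwise bounds by \<open>\<bar>v y\<bar>\<close> plus the \<open>L\<^sup>1\<close> norm of \<open>v\<close> into \<open>L\<^sup>2\<close> bounds.\<close>

lemma (in prob_space) square_integrable_dominated:
  fixes f v :: "'a \<Rightarrow> real"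
  assumes [measurable]: "f \<in> borel_measurable M" "v \<in> borel_measurable M"
    and v2: "integrable M (\<lambda>y. (v y)\<^sup>2)"
    and le: "\<And>y. y \<in> space M \<Longrightarrow> \<bar>f y\<bar> \<le> r * (\<bar>v y\<bar> + (\<integral>z. \<bar>v z\<bar> \<partial>M))"
  shows "integrable M (\<lambda>y. (f y)\<^sup>2)"
    and "(\<integral>y. (f y)\<^sup>2 \<partial>M) \<le> (2 * r)\<^sup>2 * (\<integral>y. (v y)\<^sup>2 \<partial>M)"
proof -
  define A where "A = (\<integral>z. \<bar>v z\<bar> \<partial>M)"
  have sq: "(f y)\<^sup>2 \<le> 2 * r\<^sup>2 * ((v y)\<^sup>2 + A\<^sup>2)" if "y \<in> space M" for y
  proof -
    have "(f y)\<^sup>2 \<le> (r * (\<bar>v y\<bar> + A))\<^sup>2"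
      using power_mono[OF le[OF that] abs_ge_zero, of 2] by (simp add: A_def)
    also have "\<dots> = r\<^sup>2 * (\<bar>v y\<bar> + A)\<^sup>2" by (simp add: power_mult_distrib)
    also have "\<dots> \<le> r\<^sup>2 * (2 * ((v y)\<^sup>2 + A\<^sup>2))"
    proof (intro mult_left_mono)
      have "0 \<le> (\<bar>v y\<bar> - A)\<^sup>2" by simp
      then show "(\<bar>v y\<bar> + A)\<^sup>2 \<le> 2 * ((v y)\<^sup>2 + A\<^sup>2)"
        by (simp add: power2_sum power2_diff)
    qed simp
    finally show ?thesis by (simp add: algebra_simps)
  qed
  have dom: "integrable M (\<lambda>y. 2 * r\<^sup>2 * ((v y)\<^sup>2 + A\<^sup>2))" using v2 by simp
  show int: "integrable M (\<lambda>y. (f y)\<^sup>2)"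
    using sq by (intro Bochner_Integration.integrable_bound[OF dom]) (auto intro!: AE_I2)
  have "(\<integral>y. (f y)\<^sup>2 \<partial>M) \<le> (\<integral>y. 2 * r\<^sup>2 * ((v y)\<^sup>2 + A\<^sup>2) \<partial>M)"
    using sq by (intro integral_mono int dom)
  also have "\<dots> = 2 * r\<^sup>2 * ((\<integral>y. (v y)\<^sup>2 \<partial>M) + A\<^sup>2)"
    using v2 by (simp add: prob_space)
  also have "\<dots> \<le> 2 * r\<^sup>2 * ((\<integral>y. (v y)\<^sup>2 \<partial>M) + (\<integral>y. (v y)\<^sup>2 \<partial>M))"
    unfolding A_def using L1_sq_le_L2_sq[OF _ v2] by (intro mult_left_mono add_left_mono) auto
  finally show "(\<integral>y. (f y)\<^sup>2 \<partial>M) \<le> (2 * r)\<^sup>2 * (\<integral>y. (v y)\<^sup>2 \<partial>M)"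
    by (simp add: power_mult_distrib)
qed

section \<open>The unit cell as a probability space\<close>

definition cell :: "(real ^ 'd) measure"
  where "cell = restrict_space lebesgue unit_cell"

lemma unit_cell_lebesgue: "unit_cell \<in> sets lebesgue"
  by (simp add: unit_cell_def)

lemma space_cell: "space cell = unit_cell"
  by (simp add: cell_def space_restrict_space)

lemma measurable_cell: "v \<in> borel_measurable lebesgue \<Longrightarrow> v \<in> borel_measurable cell"
  by (simp add: cell_def measurable_restrict_space1)

lemma mean_eq: "mean v = integral\<^sup>L cell v"
  by (simp add: mean_def cell_def set_lebesgue_integral_def integral_restrict_space
      unit_cell_lebesgue)

lemma prob_space_cell: "prob_space (cell :: (real ^ 'd) measure)"
proof
  have one: "(1 :: real ^ 'd) \<bullet> b = 1" if "b \<in> Basis" for b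
    using that by (auto simp: Basis_vec_def inner_axis)
  have "emeasure lborel (box 0 (1 :: real ^ 'd)) = 1"
    using one by (simp add: emeasure_lborel_box_eq)
  then show "emeasure (cell :: (real ^ 'd) measure) (space cell) = 1"
    unfolding space_cell
    by (simp add: cell_def emeasure_restrict_space unit_cell_lebesgue) (simp add: unit_cell_def)
qed

lemma L2_norm_eq: "L2_norm v = sqrt (\<integral>y. (v y)\<^sup>2 \<partial>cell)"
  by (simp add: L2_norm_def mean_eq)

lemma L2_per_iff:
  "v \<in> L2_per \<longleftrightarrow>
    v \<in> borel_measurable lebesgue \<and> periodic v \<and> integrable cell (\<lambda>y. (v y)\<^sup>2)"
  by (simp add: L2_per_def cell_def set_integrable_def integrable_restrict_space
      unit_cell_lebesgue)

section \<open>The operator exponential\<close>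

locale periodic_weight =
  fixes \<sigma> :: "real ^ 'd \<Rightarrow> real" and m S :: real
  assumes C_per: "\<sigma> \<in> C_per"
    and pos: "0 < m"
    and bounds: "\<And>y. y \<in> unit_cell \<Longrightarrow> m \<le> \<sigma> y" "\<And>y. y \<in> unit_cell \<Longrightarrow> \<sigma> y \<le> S"
begin

lemma weight_lebesgue [measurable]: "\<sigma> \<in> borel_measurable lebesgue"
  using C_per by (auto simp: C_per_def intro!: measurable_completion borel_measurable_continuous_onI)

sublocale bounded_weight cell \<sigma> m S
  unfolding bounded_weight_def bounded_weight_axioms_def
  using prob_space_cell measurable_cell[OF weight_lebesgue] pos bounds by (auto simp: space_cell)

lemma L_op_eq: "L_op \<sigma> = L"
  by (intro ext) (simp add: L_op_def L_def mean_eq)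

lemma L_power_lebesgue:
  assumes "v \<in> borel_measurable lebesgue"
  shows "(L ^^ n) v \<in> borel_measurable lebesgue"
proof (induction n)
  case (Suc n)
  have "(L ^^ Suc n) v = (\<lambda>y. \<sigma> y * (L ^^ n) v y - (\<integral>z. \<sigma> z * (L ^^ n) v z \<partial>cell))"
    by (simp add: L_def)
  then show ?case
    by (simp only:) (intro borel_measurable_diff borel_measurable_times borel_measurable_const
        weight_lebesgue Suc)
qed (use assms in simp)

lemma L_power_periodic:
  assumes "periodic v"
  shows "periodic ((L ^^ n) v)"
  using C_per by (induction n) (use assms in \<open>auto simp: L_def periodic_def C_per_def\<close>)

lemma L2_per_integrable:
  fixes v :: "real ^ 'd \<Rightarrow> real"
  shows "v \<in> L2_per \<Longrightarrow> integrable cell v"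
  by (rule square_integrable_imp_integrable) (auto simp: L2_per_iff intro: measurable_cell)

definition exp_partial :: "real \<Rightarrow> nat \<Rightarrow> (real ^ 'd \<Rightarrow> real) \<Rightarrow> real ^ 'd \<Rightarrow> real"
  where "exp_partial t N v = (\<lambda>y. \<Sum>n<N. t ^ n / fact n * (L ^^ n) v y)"

definition exp_sum :: "real \<Rightarrow> (real ^ 'd \<Rightarrow> real) \<Rightarrow> real ^ 'd \<Rightarrow> real"
  where "exp_sum t v = (\<lambda>y. \<Sum>n. t ^ n / fact n * (L ^^ n) v y)"

lemma exp_partial_lebesgue: "v \<in> L2_per \<Longrightarrow> exp_partial t N v \<in> borel_measurable lebesgue"
  using L_power_lebesgue[of v] unfolding exp_partial_def
  by (intro borel_measurable_sum borel_measurable_times) (auto simp: L2_per_iff)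

lemma exp_sum_lebesgue: "v \<in> L2_per \<Longrightarrow> exp_sum t v \<in> borel_measurable lebesgue"
  using L_power_lebesgue[of v] unfolding exp_sum_def
  by (intro borel_measurable_suminf borel_measurable_times) (auto simp: L2_per_iff)

lemma exp_partial_L2_per:
  assumes v: "v \<in> L2_per"
  shows "exp_partial t N v \<in> L2_per"
  unfolding L2_per_iff
proof (intro conjI)
  show "periodic (exp_partial t N v)"
    using v L_power_periodic[of v] by (simp add: L2_per_iff periodic_def exp_partial_def)
  show "integrable cell (\<lambda>y. (exp_partial t N v y)\<^sup>2)"
    by (rule square_integrable_dominated(1)[where v = v])
      (use v exp_partial_lebesgue[OF v] exp_series_L_partial_le[OF L2_per_integrable[OF v]] in
        \<open>auto simp: L2_per_iff exp_partial_def intro: measurable_cell\<close>)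
qed (rule exp_partial_lebesgue[OF v])

lemma exp_sum_L2_per:
  assumes v: "v \<in> L2_per"
  shows "exp_sum t v \<in> L2_per"
  unfolding L2_per_iff
proof (intro conjI)
  show "periodic (exp_sum t v)"
    using v L_power_periodic[of v] by (simp add: L2_per_iff periodic_def exp_sum_def)
  show "integrable cell (\<lambda>y. (exp_sum t v y)\<^sup>2)"
  proof (rule square_integrable_dominated(1)[where v = v])
    show "\<bar>exp_sum t v y\<bar> \<le>
        (\<Sum>n. (3 * S * \<bar>t\<bar>) ^ n /\<^sub>R fact n) * (\<bar>v y\<bar> + (\<integral>z. \<bar>v z\<bar> \<partial>cell))"
      if "y \<in> space cell" for y
      using exp_series_L_tail[OF L2_per_integrable[OF v] that, where N = 0 and t = t] by (simp add: exp_sum_def)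
  qed (use v exp_sum_lebesgue[OF v] in \<open>auto simp: L2_per_iff intro: measurable_cell\<close>)
qed (rule exp_sum_lebesgue[OF v])

text \<open>The factor in front of \<open>L2_norm v\<close> does not depend on \<open>v\<close>: this is convergence in operator
  norm.\<close>

lemma L2_norm_exp_tail_le:
  assumes v: "v \<in> L2_per"
  shows "L2_norm (\<lambda>y. exp_partial t N v y - exp_sum t v y) \<le>
    2 * (\<Sum>n. (3 * S * \<bar>t\<bar>) ^ (n + N) /\<^sub>R fact (n + N)) * L2_norm v"
proof -
  define r where "r = (\<Sum>n. (3 * S * \<bar>t\<bar>) ^ (n + N) /\<^sub>R fact (n + N))"
  have "summable (\<lambda>n. (3 * S * \<bar>t\<bar>) ^ (n + N) /\<^sub>R fact (n + N))"
    by (rule summable_ignore_initial_segment[OF summable_exp_generic])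
  then have r: "0 \<le> r"
    unfolding r_def using S_pos by (intro suminf_nonneg) auto
  have "(\<integral>y. (exp_partial t N v y - exp_sum t v y)\<^sup>2 \<partial>cell) \<le> (2 * r)\<^sup>2 * (\<integral>y. (v y)\<^sup>2 \<partial>cell)"
  proof (rule square_integrable_dominated(2))
    show "\<bar>exp_partial t N v y - exp_sum t v y\<bar> \<le> r * (\<bar>v y\<bar> + (\<integral>z. \<bar>v z\<bar> \<partial>cell))"
      if "y \<in> space cell" for y
      unfolding exp_partial_def exp_sum_def r_def
      by (rule exp_series_L_tail[OF L2_per_integrable[OF v] that])
  qed (use v exp_partial_lebesgue[OF v] exp_sum_lebesgue[OF v] in
      \<open>auto simp: L2_per_iff intro!: measurable_cell borel_measurable_diff\<close>)
  then have "L2_norm (\<lambda>y. exp_partial t N v y - exp_sum t v y) \<le>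
      sqrt ((2 * r)\<^sup>2 * (\<integral>y. (v y)\<^sup>2 \<partial>cell))"
    unfolding L2_norm_eq by (rule real_sqrt_le_mono)
  also have "\<dots> = 2 * r * L2_norm v"
    using r by (simp add: L2_norm_eq real_sqrt_mult)
  finally show ?thesis by (simp add: r_def)
qed

lemma L2_norm_nonneg: "0 \<le> L2_norm v"
  by (simp add: L2_norm_eq)

lemma op_limit_exp_sum: "op_limit (exp_partial t) (exp_sum t)"
  unfolding op_limit_def
proof (intro conjI ballI allI impI)
  let ?e = "\<lambda>n. (3 * S * \<bar>t\<bar>) ^ n /\<^sub>R fact n"
  fix \<epsilon> :: real assume "\<epsilon> > 0"
  have e: "summable ?e" by (rule summable_exp_generic)
  have "(\<lambda>N. suminf ?e - (\<Sum>n<N. ?e n)) \<longlonglongrightarrow> suminf ?e - suminf ?e"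
    by (intro tendsto_intros summable_LIMSEQ e)
  then have "(\<lambda>N. \<Sum>n. ?e (n + N)) \<longlonglongrightarrow> 0"
    by (simp only: suminf_minus_initial_segment[OF e] diff_self)
  then have "\<forall>\<^sub>F N in sequentially. (\<Sum>n. ?e (n + N)) < \<epsilon> / 2"
    using \<open>\<epsilon> > 0\<close> by (intro order_tendstoD) auto
  then show "\<forall>\<^sub>F N in sequentially. \<forall>v\<in>L2_per.
      L2_norm (\<lambda>y. exp_partial t N v y - exp_sum t v y) \<le> \<epsilon> * L2_norm v"
  proof eventually_elim
    case (elim N)
    show ?case
    proof
      fix v :: "real ^ 'd \<Rightarrow> real" assume v: "v \<in> L2_per"
      have "2 * (\<Sum>n. ?e (n + N)) * L2_norm v \<le> \<epsilon> * L2_norm v"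
        using elim by (intro mult_right_mono L2_norm_nonneg) simp
      with L2_norm_exp_tail_le[OF v, of t N]
      show "L2_norm (\<lambda>y. exp_partial t N v y - exp_sum t v y) \<le> \<epsilon> * L2_norm v"
        by simp
    qed
  qed
qed (rule exp_sum_L2_per)

lemma op_limit_exp_op: "op_limit (exp_partial t) (exp_op (L_op \<sigma>) t)"
proof -
  have "exp_partial t = (\<lambda>N v y. \<Sum>n<N. t ^ n / fact n * (L_op \<sigma> ^^ n) v y)"
    by (intro ext) (simp add: exp_partial_def L_op_eq)
  then show ?thesis
    unfolding exp_op_def using op_limit_exp_sum by (metis someI)
qed

text \<open>The exponential is known only through \<open>op_limit\<close>, so the argument must work for any limit:
  the pairing with \<open>\<sigma>\<close> is continuous in the \<open>L\<^sup>2\<close> norm and passes to the limit of the partial sums.\<close>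

lemma mean_weight_exp_op_sums:
  assumes v: "v \<in> L2_per"
  shows "(\<lambda>n. t ^ n / fact n * (\<integral>y. \<sigma> y * (L ^^ n) v y \<partial>cell)) sums
    mean (\<lambda>y. \<sigma> y * exp_op (L_op \<sigma>) t v y)"
proof -
  define E where "E = exp_op (L_op \<sigma>) t v"
  define D where "D N y = exp_partial t N v y - E y" for N y
  have E: "E \<in> L2_per"
    using op_limit_exp_op[of t] v by (auto simp: op_limit_def E_def)
  have small: "\<forall>\<^sub>F N in sequentially. L2_norm (D N) \<le> \<epsilon> * L2_norm v" if "\<epsilon> > 0" for \<epsilon>
    using op_limit_exp_op[of t] v that
    by (fastforce simp: op_limit_def E_def D_def[abs_def] elim: eventually_mono)
  have partial: "(\<integral>y. \<sigma> y * exp_partial t N v y \<partial>cell) =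
      (\<Sum>n<N. t ^ n / fact n * (\<integral>y. \<sigma> y * (L ^^ n) v y \<partial>cell))" for N
  proof -
    have "(\<integral>y. \<sigma> y * exp_partial t N v y \<partial>cell) =
        (\<integral>y. (\<Sum>n<N. t ^ n / fact n * (\<sigma> y * (L ^^ n) v y)) \<partial>cell)"
      by (simp add: exp_partial_def sum_distrib_left mult_ac)
    also have "\<dots> = (\<Sum>n<N. t ^ n / fact n * (\<integral>y. \<sigma> y * (L ^^ n) v y \<partial>cell))"
      by (subst Bochner_Integration.integral_sum)
        (auto intro!: integrable_mult_right integrable_weight_mult integrable_L_power
          L2_per_integrable[OF v])
    finally show ?thesis .
  qed
  have D_le: "\<bar>(\<integral>y. \<sigma> y * exp_partial t N v y \<partial>cell) - (\<integral>y. \<sigma> y * E y \<partial>cell)\<bar> \<le> S * L2_norm (D N)" for N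
  proof -
    have int: "integrable cell (exp_partial t N v)" "integrable cell E"
      using L2_per_integrable exp_partial_L2_per v E by auto
    have sq: "integrable cell (\<lambda>y. (D N y)\<^sup>2)"
    proof (rule Bochner_Integration.integrable_bound)
      show "integrable cell (\<lambda>y. 2 * (exp_partial t N v y)\<^sup>2 + 2 * (E y)\<^sup>2)"
        using E exp_partial_L2_per[OF v] by (simp add: L2_per_iff)
      have "(a - b)\<^sup>2 \<le> 2 * a\<^sup>2 + 2 * b\<^sup>2" for a b :: real
        using zero_le_power2[of "a + b"] unfolding power2_sum power2_diff by linarith
      then show "AE y in cell. norm ((D N y)\<^sup>2) \<le>
          norm (2 * (exp_partial t N v y)\<^sup>2 + 2 * (E y)\<^sup>2)"
        by (simp add: D_def)
    qed (use int in \<open>auto simp: D_def[abs_def]\<close>)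
    have int_D: "integrable cell (D N)" using int by (simp add: D_def[abs_def])
    have "(\<integral>y. \<sigma> y * exp_partial t N v y \<partial>cell) - (\<integral>y. \<sigma> y * E y \<partial>cell) = (\<integral>y. \<sigma> y * D N y \<partial>cell)"
      using int by (simp add: D_def right_diff_distrib integrable_weight_mult)
    also have "\<bar>\<dots>\<bar> \<le> S * (\<integral>y. \<bar>D N y\<bar> \<partial>cell)"
      by (rule abs_integral_weight_mult_le[OF int_D])
    also have "\<dots> \<le> S * L2_norm (D N)"
      unfolding L2_norm_eq using S_pos int_D sq
      by (intro mult_left_mono real_le_rsqrt L1_sq_le_L2_sq) auto
    finally show ?thesis .
  qed
  have "(\<lambda>N. \<integral>y. \<sigma> y * exp_partial t N v y \<partial>cell) \<longlonglongrightarrow> (\<integral>y. \<sigma> y * E y \<partial>cell)"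
  proof (rule tendstoI)
    fix e :: real assume e: "e > 0"
    (* Adding 1 keeps the denominator positive when v has norm 0. *)
    define \<epsilon> where "\<epsilon> = e / (S * L2_norm v + 1)"
    have nn: "0 \<le> S * L2_norm v" using S_pos L2_norm_nonneg[of v] by simp
    then have \<epsilon>: "\<epsilon> > 0" "S * (\<epsilon> * L2_norm v) < e"
      using e by (auto simp: \<epsilon>_def field_simps)
    show "\<forall>\<^sub>F N in sequentially.
        dist (\<integral>y. \<sigma> y * exp_partial t N v y \<partial>cell) (\<integral>y. \<sigma> y * E y \<partial>cell) < e"
      using small[OF \<epsilon>(1)]
    proof eventually_elim
      case (elim N)
      then have "S * L2_norm (D N) \<le> S * (\<epsilon> * L2_norm v)"
        using S_pos by (intro mult_left_mono) auto
      with D_le[of N] \<epsilon>(2) show ?case by (simp add: dist_real_def)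
    qed
  qed
  then show ?thesis
    by (simp add: sums_def partial mean_eq E_def)
qed

lemma fluctuation_L2_per: "(\<lambda>z. \<sigma> z - mean \<sigma>) \<in> L2_per"
  unfolding L2_per_iff
proof (intro conjI)
  show "periodic (\<lambda>z. \<sigma> z - mean \<sigma>)"
    using C_per by (simp add: C_per_def periodic_def)
  show "integrable cell (\<lambda>z. (\<sigma> z - mean \<sigma>)\<^sup>2)"
  proof (rule integrable_const_bound[where B = "(S + \<bar>mean \<sigma>\<bar>)\<^sup>2"])
    have "\<bar>\<sigma> z - mean \<sigma>\<bar> \<le> \<bar>S + \<bar>mean \<sigma>\<bar>\<bar>" if "z \<in> space cell" for z
      using abs_weight_le[OF that] by linarith
    then show "AE z in cell. norm ((\<sigma> z - mean \<sigma>)\<^sup>2) \<le> (S + \<bar>mean \<sigma>\<bar>)\<^sup>2"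
      by (auto simp: abs_le_square_iff)
  qed measurable
qed measurable

section \<open>The Laplace transform of the kernel\<close>

lemma K_kernel_eq:
  "K_kernel \<sigma> \<tau> = exp (- S * \<tau>) * (\<Sum>n. \<tau> ^ n / fact n *
    (\<integral>y. \<sigma> y * (T ^^ n) (\<lambda>z. \<sigma> z - mean \<sigma>) y \<partial>cell))"
  unfolding K_kernel_def
  by (rule sums_unique2[OF mean_weight_exp_op_sums exp_series_L_eq_T])
    (auto intro: fluctuation_L2_per L2_per_integrable)

lemma laplace_K_kernel:
  assumes p: "p > 0"
  shows "laplace_exists (K_kernel \<sigma>) p" and "laplace (K_kernel \<sigma>) p = M_laplace \<sigma> p"
proof -
  define g where "g = (\<lambda>z. \<sigma> z - mean \<sigma>)"
  define c where "c n = (\<integral>y. \<sigma> y * (T ^^ n) g y \<partial>cell)" for n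
  have g: "integrable cell g"
    unfolding g_def by (rule L2_per_integrable[OF fluctuation_L2_per])
  have "\<bar>c n\<bar> \<le> S * (\<integral>y. \<bar>g y\<bar> \<partial>cell) * S ^ n" for n
    unfolding c_def by (rule abs_integral_weight_T_power_le[OF g])
  from laplace_power_series[OF p _ this]
  have "has_bochner_integral lborel (\<lambda>t. indicator {0..} t * (exp (- p * t) * K_kernel \<sigma> t))
      (\<Sum>n. c n / (p + S) ^ Suc n)"
    using S_pos by (simp add: K_kernel_eq c_def g_def)
  moreover have "(\<Sum>n. c n / (p + S) ^ Suc n) = M_laplace \<sigma> p"
    using sum_weighted_means_eq[OF p] by (simp add: c_def g_def mean_eq M_laplace_def B_fun_def)
  ultimately have K: "integrable lborel (\<lambda>t. indicator {0..} t * (exp (- p * t) * K_kernel \<sigma> t))"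
    "(\<integral>t. indicator {0..} t * (exp (- p * t) * K_kernel \<sigma> t) \<partial>lborel) = M_laplace \<sigma> p"
    by (auto simp: has_bochner_integral_iff)
  note meas = borel_measurable_integrable[OF K(1)]
  show "laplace_exists (K_kernel \<sigma>) p"
    using K(1) integrable_completion[OF meas] by (simp add: laplace_exists_def set_integrable_def)
  show "laplace (K_kernel \<sigma>) p = M_laplace \<sigma> p"
    using K(2) integral_completion[OF meas] by (simp add: laplace_def set_lebesgue_integral_def)
qed

end

text \<open>The upper bound \<open>S\<close> exists because \<open>\<sigma>\<close> is continuous on the compact closure of the cell.\<close>

theorem theorem8:
  fixes \<sigma> :: "real ^ 'd \<Rightarrow> real" and \<sigma>_min p :: real
  assumes "\<sigma> \<in> C_per"
    and "\<sigma>_min > 0"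
    and "\<And>y. y \<in> unit_cell \<Longrightarrow> \<sigma> y \<ge> \<sigma>_min"
    and "p > 0"
  shows "laplace_exists (K_kernel \<sigma>) p \<and> laplace (K_kernel \<sigma>) p = M_laplace \<sigma> p"
proof -
  have "continuous_on (cbox 0 1) \<sigma>"
    using assms(1) by (auto simp: C_per_def intro: continuous_on_subset)
  then have "bounded (\<sigma> ` cbox 0 1)"
    by (intro compact_imp_bounded compact_continuous_image compact_cbox)
  then obtain S where S: "\<And>y. y \<in> cbox 0 1 \<Longrightarrow> \<bar>\<sigma> y\<bar> \<le> S"
    by (auto simp: bounded_iff)
  have "\<sigma> y \<le> S" if "y \<in> unit_cell" for y
    using S[of y] that box_subset_cbox[of 0 "1 :: real ^ 'd"] by (auto simp: unit_cell_def)
  then interpret periodic_weight \<sigma> \<sigma>_min S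
    using assms by unfold_locales auto
  show ?thesis using laplace_K_kernel[OF assms(4)] by blast
qed

end
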